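(* Let $H$ be a finite, connected hypergraph such that every hypervertex of $H$ is in at least two hyperedges, and let $B_H$ be its associated bipartite graph. Then $$\zeta_H(u) = Z_{B_H}(\sqrt{u}).$$
   Context: A hypergraph $H=(V,E)$ consists of a set $V=V(H)$ of hypervertices and a family $E=E(H)$ of hyperedges, each hyperedge being a nonempty subset of $V$, with the union of all hyperedges equal to $V$. Repeated hyperedges are allowed and count as distinct elements of $E$. The associated bipartite graph $B_H$ has vertex set $V\sqcup E$, with $v\in V$ adjacent to $e\in E$ if and only if $v\in e$. $H$ is connected if $B_H$ is connected. A closed path of length $k\ge 1$ in $H$ is a sequence $c=(v_1,e_1,v_2,e_2,\dots,v_k,e_k,v_1)$ with $v_i\in e_{i-1}\cap e_i$ and $v_i\ne v_{i+1}$ for all $i\in\mathbb Z/k\mathbb Z$. It has hyperedge backtracking if it contains a subsequence of consecutive entries $(e,v,e)$ (the same element of $E$ used twice in a row). $c^m$ denotes the closed path going around $c$ $m$ times; $c$ is tail-less if $c^2$ has no hyperedge backtracking. A primitive cycle is a closed path that has no hyperedge backtracking, is tail-less, and is not of the form $b^m$ with $m\ge 2$ for a closed path $b$. A prime cycle $\mathfrak p$ is an equivalence class of primitive cycles under cyclic permutation (direction of travel matters); $|\mathfrak p|$ is its length. The generalized Ihara-Selberg zeta function is, for $u\in\mathbb C$ with $|u|$ sufficiently small, $$\zeta_H(u)=\prod_{\mathfrak p}\left(1-u^{|\mathfrak p|}\right)^{-1},$$ the product over all prime cycles of $H$. For a finite graph $X$, the Ihara-Selberg zeta function is $Z_X(u)=\prod_{\ell}(1-u^{|\ell|})^{-1}$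 for $|u|$ sufficiently small, the product over prime geodesics $\ell$ of $X$: equivalence classes, under cyclic permutation, of closed walks without backtracking (no edge followed immediately by its inverse), tail-less (the square of the walk has no backtracking) and not an $m$-fold multiple ($m\ge 2$) of another closed walk; $|\ell|$ is the number of edges. Since $B_H$ is bipartite, all its prime geodesics have even length, so $Z_{B_H}(\sqrt u)$ does not depend on the choice of square root. Identities of zeta functions are understood for $|u|$ sufficiently small, equivalently as rational functions. *)

theory Defs
  imports
    "HOL-Analysis.Analysis"
    "Graph_Theory.Digraph_Component"
    "Graph_Theory.Pair_Digraph"
begin

section \<open>Unordered infinite products\<close>

text \<open>
  The multiplicative analogue of \<^const>\<open>has_sum\<close>. As usual for infinite products,
  convergence includes that the limit is nonzero.
\<close>

definition has_unordered_prod :: "('i \<Rightarrow> complex) \<Rightarrow> 'i set \<Rightarrow> complex \<Rightarrow> bool" where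
  "has_unordered_prod f A z \<longleftrightarrow> z \<noteq> 0 \<and> (prod f \<longlongrightarrow> z) (finite_subsets_at_top A)"

definition multipliable_on :: "('i \<Rightarrow> complex) \<Rightarrow> 'i set \<Rightarrow> bool" where
  "multipliable_on f A \<longleftrightarrow> (\<exists>z. has_unordered_prod f A z)"

definition unordered_prod :: "('i \<Rightarrow> complex) \<Rightarrow> 'i set \<Rightarrow> complex" where
  "unordered_prod f A = Lim (finite_subsets_at_top A) (prod f)"


section \<open>Classes of cyclic sequences\<close>

definition cyclic_rel :: "'a list set \<Rightarrow> ('a list \<times> 'a list) set" where
  "cyclic_rel S = {(c, d). c \<in> S \<and> d \<in> S \<and> (\<exists>n. d = rotate n c)}"

definition cyclic_classes :: "'a list set \<Rightarrow> 'a list set set" where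
  "cyclic_classes S = S // cyclic_rel S"

lemma equiv_cyclic_rel: "equiv S (cyclic_rel S)"
proof (rule equivI)
  show "cyclic_rel S \<subseteq> S \<times> S"
    by (auto simp: cyclic_rel_def)
  show "refl_on S (cyclic_rel S)"
    by (auto simp: refl_on_def cyclic_rel_def intro!: exI[of _ 0])
  show "sym (cyclic_rel S)"
  proof (rule symI)
    fix c d assume "(c, d) \<in> cyclic_rel S"
    then obtain n where "c \<in> S" "d \<in> S" "d = rotate n c"
      by (auto simp: cyclic_rel_def)
    moreover have "c = rotate (length c - n mod length c) (rotate n c)"
    proof (cases "c = []")
      case False
      then have "(length c - n mod length c) + n mod length c = length c"
        by (simp add: less_imp_le)
      then have "rotate (length c - n mod length c) (rotate (n mod length c) c) = c"
        by (simp add: rotate_rotate)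
      then show ?thesis
        by (metis rotate_conv_mod)
    qed simp
    ultimately show "(d, c) \<in> cyclic_rel S"
      by (auto simp: cyclic_rel_def)
  qed
  show "trans (cyclic_rel S)"
    by (auto simp: trans_def cyclic_rel_def rotate_rotate)
qed

text \<open>All members of a class have the same length, so the image below is a singleton.\<close>

definition class_length :: "'a list set \<Rightarrow> nat" where
  "class_length P = the_elem (length ` P)"

lemma class_length_eq:
  assumes "P \<in> cyclic_classes S" "c \<in> P"
  shows "class_length P = length c"
proof -
  have "length ` P = {length c}"
    using assms by (auto simp: cyclic_classes_def cyclic_rel_def elim!: quotientE)
  then show ?thesis
    by (simp add: class_length_def)
qed

definition euler_factor :: "complex \<Rightarrow> 'a list set \<Rightarrow> complex" where
  "euler_factor u P = inverse (1 - u ^ class_length P)"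


section \<open>Hypergraphs and their zeta function\<close>

text \<open>
  Hyperedges are labels with an underlying vertex set, so that repeated hyperedges are
  distinct elements of \<open>hedges\<close>.
\<close>

record ('v, 'e) hypergraph =
  hverts :: "'v set"
  hedges :: "'e set"
  hends :: "'e \<Rightarrow> 'v set"

definition is_hypergraph :: "('v, 'e) hypergraph \<Rightarrow> bool" where
  "is_hypergraph H \<longleftrightarrow>
     (\<forall>e\<in>hedges H. hends H e \<noteq> {} \<and> hends H e \<subseteq> hverts H) \<and>
     (\<Union>e\<in>hedges H. hends H e) = hverts H"

definition finite_hypergraph :: "('v, 'e) hypergraph \<Rightarrow> bool" where
  "finite_hypergraph H \<longleftrightarrow> finite (hverts H) \<and> finite (hedges H)"

text \<open>As usual in \<open>Graph_Theory\<close>, an undirected edge is a pair of opposite arcs.\<close>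

definition bipartite_graph :: "('v, 'e) hypergraph \<Rightarrow> ('v + 'e) pair_pre_digraph" where
  "bipartite_graph H =
     \<lparr> pverts = hverts H <+> hedges H,
       parcs = {(Inl v, Inr e) | v e. v \<in> hverts H \<and> e \<in> hedges H \<and> v \<in> hends H e} \<union>
               {(Inr e, Inl v) | v e. v \<in> hverts H \<and> e \<in> hedges H \<and> v \<in> hends H e} \<rparr>"

lemma pair_bidirected_bipartite_graph: "pair_bidirected_digraph (bipartite_graph H)"
  by unfold_locales (auto simp: bipartite_graph_def symmetric_def intro!: symI)

definition connected_hypergraph :: "('v, 'e) hypergraph \<Rightarrow> bool" where
  "connected_hypergraph H \<longleftrightarrow> Digraph_Component.connected (with_proj (bipartite_graph H))"

text \<open>
  The closed path $(v_1,e_1,\ldots,v_k,e_k,v_1)$ is the list of the pairs $(v_i,e_i)$, its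
  length is $k$, and going around it \<open>m\<close> times is \<open>concat (replicate m c)\<close>.
\<close>

definition closed_path :: "('v, 'e) hypergraph \<Rightarrow> ('v \<times> 'e) list \<Rightarrow> bool" where
  "closed_path H c \<longleftrightarrow> c \<noteq> [] \<and>
     (\<forall>i<length c.
        snd (c ! i) \<in> hedges H \<and>
        fst (c ! i) \<in> hends H (snd (c ! i)) \<and>
        fst (c ! (Suc i mod length c)) \<in> hends H (snd (c ! i)) \<and>
        fst (c ! i) \<noteq> fst (c ! (Suc i mod length c)))"

text \<open>No wrap-around here: the written-out sequence ends with $e_k, v_1$.\<close>

definition hyperedge_backtracking :: "('v \<times> 'e) list \<Rightarrow> bool" where
  "hyperedge_backtracking c \<longleftrightarrow> (\<exists>i. Suc i < length c \<and> snd (c ! i) = snd (c ! Suc i))"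

definition primitive_cycle :: "('v, 'e) hypergraph \<Rightarrow> ('v \<times> 'e) list \<Rightarrow> bool" where
  "primitive_cycle H c \<longleftrightarrow> closed_path H c \<and>
     \<not> hyperedge_backtracking c \<and>
     \<not> hyperedge_backtracking (c @ c) \<and>
     \<not> (\<exists>b m. closed_path H b \<and> m \<ge> 2 \<and> c = concat (replicate m b))"

definition prime_cycles :: "('v, 'e) hypergraph \<Rightarrow> ('v \<times> 'e) list set set" where
  "prime_cycles H = cyclic_classes {c. primitive_cycle H c}"

definition hypergraph_zeta :: "('v, 'e) hypergraph \<Rightarrow> complex \<Rightarrow> complex" where
  "hypergraph_zeta H u = unordered_prod (euler_factor u) (prime_cycles H)"


section \<open>The Ihara-Selberg zeta function of a graph\<close>

text \<open>
  Graphs with arc reversal \<open>arev\<close> are as in \<^locale>\<open>bidirected_digraph\<close>, which allows loops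
  and multiple edges; \<^const>\<open>wf_digraph.closed_w\<close> are the nonempty closed walks, given as
  lists of arcs.
\<close>

definition walk_backtracking :: "('b \<Rightarrow> 'b) \<Rightarrow> 'b list \<Rightarrow> bool" where
  "walk_backtracking arev p \<longleftrightarrow> (\<exists>i. Suc i < length p \<and> p ! Suc i = arev (p ! i))"

definition primitive_geodesic ::
  "('a, 'b) pre_digraph \<Rightarrow> ('b \<Rightarrow> 'b) \<Rightarrow> 'b list \<Rightarrow> bool" where
  "primitive_geodesic G arev p \<longleftrightarrow> wf_digraph.closed_w G p \<and>
     \<not> walk_backtracking arev p \<and>
     \<not> walk_backtracking arev (p @ p) \<and>
     \<not> (\<exists>b m. wf_digraph.closed_w G b \<and> m \<ge> 2 \<and> p = concat (replicate m b))"

definition prime_geodesics ::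
  "('a, 'b) pre_digraph \<Rightarrow> ('b \<Rightarrow> 'b) \<Rightarrow> 'b list set set" where
  "prime_geodesics G arev = cyclic_classes {p. primitive_geodesic G arev p}"

definition ihara_zeta ::
  "('a, 'b) pre_digraph \<Rightarrow> ('b \<Rightarrow> 'b) \<Rightarrow> complex \<Rightarrow> complex" where
  "ihara_zeta G arev u = unordered_prod (euler_factor u) (prime_geodesics G arev)"

text \<open>A graph without parallel arcs has only one arc reversal, namely \<^const>\<open>swap_in\<close>.\<close>

abbreviation pair_prime_geodesics :: "'a pair_pre_digraph \<Rightarrow> ('a \<times> 'a) list set set" where
  "pair_prime_geodesics G \<equiv> prime_geodesics (with_proj G) (swap_in (parcs G))"

abbreviation pair_ihara_zeta :: "'a pair_pre_digraph \<Rightarrow> complex \<Rightarrow> complex" where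
  "pair_ihara_zeta G \<equiv> ihara_zeta (with_proj G) (swap_in (parcs G))"

end

theory Submission
  imports Defs
begin

text \<open>
  Reading every hyperedge crossing $(v_i, e_i, v_{i+1})$ as the two arcs $v_i \to e_i$ and
  $e_i \to v_{i+1}$ turns a closed path of length $k$ in $H$ into a closed walk of length $2k$
  in $B_H$. This walk backtracks at $e_i$ iff $v_i = v_{i+1}$ and at $v_{i+1}$ iff
  $e_i = e_{i+1}$, so that the two different kinds of conditions on closed paths become the one
  condition on geodesics. Because $B_H$ is bipartite, a closed geodesic is such a subdivision iff it
  starts in a hypervertex, and any closed geodesic does so after at most one rotation. Hence prime
  cycles of length $k$ correspond bijectively to prime geodesics of length $2k$
  (\<open>bij_betw_prime_cycles_prime_geodesics\<close>), and since $w^{2k} = u^k$ the two Euler products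
  have the same factors.

  What makes the correspondence clean is that on both sides the objects are \<open>primitive words\<close>:
  cyclic words whose consecutive letters satisfy a local relation and that have no proper period.
  When a closed path is a power of a list, that list is automatically a closed path again, so
  primitivity does not depend on the surrounding notion of path. Local relations and periods are
  both expressed through the periodic extension \<open>cyclic_nth c\<close> of a word, on which rotation acts
  by translation.

  Convergence is the usual counting argument: a finite alphabet with $q$ letters has $q^n$ words of
  length $n$, so $\sum_P |u|^{|P|}$ converges for $q|u| < 1$, and logarithms turn this into
  convergence of the Euler product to a nonzero value. It has to be shown only for $H$, as
  the bijection transports it to $B_H$.
\<close>

section \<open>Periodic extensions of words\<close>

definition cyclic_nth :: "'a list \<Rightarrow> nat \<Rightarrow> 'a" where
  "cyclic_nth c i = c ! (i mod length c)"

lemma cyclic_nth_less: "i < length c \<Longrightarrow> cyclic_nth c i = c ! i"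
  by (simp add: cyclic_nth_def)

lemma cyclic_nth_eqI:
  assumes "length c = length d" "\<And>i. cyclic_nth c i = cyclic_nth d i"
  shows "c = d"
  using assms by (metis cyclic_nth_less nth_equalityI)

lemma cyclic_nth_rotate:
  assumes "c \<noteq> []"
  shows "cyclic_nth (rotate n c) i = cyclic_nth c (n + i)"
  using assms by (simp add: cyclic_nth_def nth_rotate mod_add_right_eq)

lemma cyclic_nth_mod_length: "cyclic_nth c (i mod length c) = cyclic_nth c i"
  and cyclic_nth_Suc_mod_length: "cyclic_nth c (Suc (i mod length c)) = cyclic_nth c (Suc i)"
  by (simp_all add: cyclic_nth_def mod_Suc_eq)

lemma all_less_cyclic_steps:
  assumes "c \<noteq> []"
  shows "(\<forall>i<length c. R (c ! i) (c ! (Suc i mod length c))) \<longleftrightarrow>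
         (\<forall>i. R (cyclic_nth c i) (cyclic_nth c (Suc i)))"
proof
  assume L: "\<forall>i<length c. R (c ! i) (c ! (Suc i mod length c))"
  show "\<forall>i. R (cyclic_nth c i) (cyclic_nth c (Suc i))"
  proof
    fix i
    have "i mod length c < length c"
      using assms by simp
    with L show "R (cyclic_nth c i) (cyclic_nth c (Suc i))"
      by (metis cyclic_nth_def mod_Suc_eq)
  qed
next
  assume "\<forall>i. R (cyclic_nth c i) (cyclic_nth c (Suc i))"
  then show "\<forall>i<length c. R (c ! i) (c ! (Suc i mod length c))"
    by (metis cyclic_nth_def cyclic_nth_less)
qed

text \<open>
  Going around twice sees every cyclic step, including the closing one, so conditions on \<open>c @ c\<close>
  are conditions on the periodic extension.
\<close>

lemma all_steps_append_self:
  assumes "c \<noteq> []"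
  shows "(\<forall>i. Suc i < length (c @ c) \<longrightarrow> R ((c @ c) ! i) ((c @ c) ! Suc i)) \<longleftrightarrow>
         (\<forall>i. R (cyclic_nth c i) (cyclic_nth c (Suc i)))"
proof -
  have double: "(c @ c) ! i = cyclic_nth c i" if "i < length (c @ c)" for i
    using that by (auto simp: cyclic_nth_def nth_append le_mod_geq)
  have inside: "Suc (i mod length c) < length (c @ c)" for i
    using assms by (metis Suc_lessI add_gr_0 length_append length_greater_0_conv
        less_add_same_cancel1 less_trans mod_less_divisor)
  show ?thesis
  proof
    assume L: "\<forall>i. Suc i < length (c @ c) \<longrightarrow> R ((c @ c) ! i) ((c @ c) ! Suc i)"
    show "\<forall>i. R (cyclic_nth c i) (cyclic_nth c (Suc i))"
    proof
      fix i
      have "R (cyclic_nth c (i mod length c)) (cyclic_nth c (Suc (i mod length c)))"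
        using L inside double by (metis Suc_lessD)
      then show "R (cyclic_nth c i) (cyclic_nth c (Suc i))"
        by (simp only: cyclic_nth_mod_length cyclic_nth_Suc_mod_length)
    qed
  next
    assume "\<forall>i. R (cyclic_nth c i) (cyclic_nth c (Suc i))"
    then show "\<forall>i. Suc i < length (c @ c) \<longrightarrow> R ((c @ c) ! i) ((c @ c) ! Suc i)"
      using double by (metis Suc_lessD)
  qed
qed

lemma length_concat_replicate: "length (concat (replicate m b)) = m * length b"
  by (induction m) auto

lemma nth_concat_replicate:
  assumes "i < m * length b"
  shows "concat (replicate m b) ! i = b ! (i mod length b)"
  using assms
proof (induction m arbitrary: i)
  case (Suc m)
  show ?case
  proof (cases "i < length b")
    case False
    then have "concat (replicate m b) ! (i - length b) = b ! ((i - length b) mod length b)"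
      using Suc by (intro Suc.IH) auto
    with False show ?thesis
      by (simp add: nth_append le_mod_geq)
  qed (simp add: nth_append)
qed simp

lemma cyclic_nth_concat_replicate:
  assumes "m > 0" "b \<noteq> []"
  shows "cyclic_nth (concat (replicate m b)) i = cyclic_nth b i"
proof -
  have "i mod (m * length b) < m * length b"
    using assms by simp
  then show ?thesis
    by (simp add: cyclic_nth_def length_concat_replicate nth_concat_replicate mod_mod_cancel)
qed


section \<open>Primitive words\<close>

text \<open>
  Primitivity in terms of rotations instead of powers: rotations are what subdivision commutes
  with, whereas the root of a subdivided word is not visibly a subdivision.
\<close>

definition aperiodic :: "'a list \<Rightarrow> bool" where
  "aperiodic c \<longleftrightarrow> c \<noteq> [] \<and> (\<forall>d. d dvd length c \<longrightarrow> rotate d c = c \<longrightarrow> d = length c)"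

text \<open>
  A list is a proper power of its first \<open>d\<close> letters iff \<open>d\<close> is a proper divisor of its length
  and rotation by \<open>d\<close> fixes it. The empty list is its own square and is therefore excluded on
  both sides.
\<close>

lemma aperiodic_iff_not_power:
  "aperiodic c \<longleftrightarrow> \<not> (\<exists>b m. m \<ge> 2 \<and> c = concat (replicate m b))"
proof
  assume ap: "aperiodic c"
  show "\<not> (\<exists>b m. m \<ge> 2 \<and> c = concat (replicate m b))"
  proof
    assume "\<exists>b m. m \<ge> 2 \<and> c = concat (replicate m b)"
    then obtain b m where m: "m \<ge> (2::nat)" and c: "c = concat (replicate m b)"
      by blast
    have "c \<noteq> []"
      using ap by (simp add: aperiodic_def)
    with c have b: "b \<noteq> []"
      by auto
    have len: "length c = m * length b"
      by (simp add: c length_concat_replicate)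
    have per: "cyclic_nth c i = cyclic_nth b i" for i
      using m b by (simp add: c cyclic_nth_concat_replicate)
    have "rotate (length b) c = c"
      by (rule cyclic_nth_eqI)
        (use \<open>c \<noteq> []\<close> per in \<open>simp_all add: cyclic_nth_rotate cyclic_nth_def[of b]\<close>)
    with ap len have "length b = m * length b"
      by (auto simp: aperiodic_def)
    with m b show False
      by simp
  qed
next
  assume np: "\<not> (\<exists>b m. m \<ge> 2 \<and> c = concat (replicate m b))"
  show "aperiodic c"
    unfolding aperiodic_def
  proof (intro conjI allI impI)
    show ne: "c \<noteq> []"
    proof
      assume "c = []"
      then have "c = concat (replicate 2 [])"
        by (simp add: numeral_2_eq_2)
      with np show False
        by blast
    qed
    fix d
    assume dvd: "d dvd length c" and rot: "rotate d c = c"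
    obtain m where m: "length c = m * d"
      using dvd by (metis dvd_def mult.commute)
    have d: "d > 0" and m0: "m > 0"
      using m ne by (auto intro!: Nat.gr0I)
    have dle: "d \<le> length c"
      using dvd ne by (simp add: dvd_imp_le)
    have shift: "cyclic_nth c (d + i) = cyclic_nth c i" for i
      using cyclic_nth_rotate[OF ne, of d i] rot by simp
    have shifts: "cyclic_nth c (n * d + i) = cyclic_nth c i" for n i
      by (induction n) (simp_all add: shift add.assoc)
    have "c = concat (replicate m (take d c))"
    proof (rule nth_equalityI)
      show "length c = length (concat (replicate m (take d c)))"
        using dle m by (simp add: length_concat_replicate)
      fix i assume i: "i < length c"
      have "c ! i = cyclic_nth c (i div d * d + i mod d)"
        using i by (simp add: cyclic_nth_less)
      also have "\<dots> = cyclic_nth c (i mod d)"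
        by (rule shifts)
      also have "\<dots> = c ! (i mod d)"
        using d dle by (intro cyclic_nth_less) (meson less_le_trans mod_less_divisor)
      also have "\<dots> = concat (replicate m (take d c)) ! i"
        using i d dle m by (simp add: nth_concat_replicate)
      finally show "c ! i = concat (replicate m (take d c)) ! i" .
    qed
    with np have "m < 2"
      by (meson not_less)
    with m0 have "m = 1"
      by simp
    with m show "d = length c"
      by simp
  qed
qed

lemma rotate_left_cancel: "rotate n c = rotate n d \<longleftrightarrow> c = d"
  using inj_fn[OF inj_rotate1, of n] by (auto simp: rotate_def inj_def)

lemma aperiodic_rotate:
  assumes "aperiodic c"
  shows "aperiodic (rotate n c)"
proof -
  have "rotate d (rotate n c) = rotate n (rotate d c)" for d
    by (simp add: rotate_rotate add.commute)
  then show ?thesis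
    using assms by (simp add: aperiodic_def rotate_left_cancel)
qed

definition primitive_words :: "('a \<Rightarrow> 'a \<Rightarrow> bool) \<Rightarrow> 'a list set" where
  "primitive_words R = {c. aperiodic c \<and> (\<forall>i. R (cyclic_nth c i) (cyclic_nth c (Suc i)))}"

lemma primitive_words_nonempty: "c \<in> primitive_words R \<Longrightarrow> c \<noteq> []"
  by (simp add: primitive_words_def aperiodic_def)

lemma primitive_words_rotate:
  "c \<in> primitive_words R \<Longrightarrow> rotate n c \<in> primitive_words R"
  using primitive_words_nonempty[of c R]
  by (simp add: primitive_words_def aperiodic_rotate cyclic_nth_rotate)

text \<open>
  The common shape of primitive cycles and primitive geodesics. The predicate \<open>circuit\<close> disappears
  from the primitivity condition, because a word has the same cyclic steps as its powers:
  every root of a closed path is a closed path.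
\<close>

lemma primitive_circuit_iff:
  assumes circuit: "\<And>b. circuit b \<longleftrightarrow>
      b \<noteq> [] \<and> (\<forall>i. P (cyclic_nth b i) (cyclic_nth b (Suc i)))"
    and backtracks: "\<And>b. backtracks b \<longleftrightarrow> (\<exists>i. Suc i < length b \<and> N (b ! i) (b ! Suc i))"
  shows "circuit c \<and> \<not> backtracks c \<and> \<not> backtracks (c @ c) \<and>
           \<not> (\<exists>b m. circuit b \<and> m \<ge> 2 \<and> c = concat (replicate m b)) \<longleftrightarrow>
         c \<in> primitive_words (\<lambda>x y. P x y \<and> \<not> N x y)"
proof (cases "c = []")
  case False
  have "backtracks (c @ c)" if "backtracks c"
  proof -
    from that backtracks obtain i where "Suc i < length c" "N (c ! i) (c ! Suc i)"
      by blast
    then show ?thesis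
      by (auto simp: backtracks nth_append intro!: exI[of _ i])
  qed
  moreover have "\<not> backtracks (c @ c) \<longleftrightarrow> (\<forall>i. \<not> N (cyclic_nth c i) (cyclic_nth c (Suc i)))"
    using all_steps_append_self[OF False, of "\<lambda>x y. \<not> N x y"] by (auto simp: backtracks)
  moreover have "circuit b" if "circuit c" "m \<ge> 2" "c = concat (replicate m b)" for b m
  proof -
    from that False have "b \<noteq> []"
      by auto
    with that show ?thesis
      by (simp add: circuit cyclic_nth_concat_replicate)
  qed
  ultimately have "circuit c \<and> \<not> backtracks c \<and> \<not> backtracks (c @ c) \<and>
      \<not> (\<exists>b m. circuit b \<and> m \<ge> 2 \<and> c = concat (replicate m b)) \<longleftrightarrow>
      circuit c \<and> aperiodic c \<and> (\<forall>i. \<not> N (cyclic_nth c i) (cyclic_nth c (Suc i)))"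
    unfolding aperiodic_iff_not_power by blast
  then show ?thesis
    using False by (simp only: primitive_words_def mem_Collect_eq circuit) blast
qed (auto simp: circuit primitive_words_def aperiodic_def)

definition cycle_step :: "('v, 'e) hypergraph \<Rightarrow> 'v \<times> 'e \<Rightarrow> 'v \<times> 'e \<Rightarrow> bool" where
  "cycle_step H x y \<longleftrightarrow>
     (snd x \<in> hedges H \<and> fst x \<in> hends H (snd x) \<and> fst y \<in> hends H (snd x) \<and>
      fst x \<noteq> fst y) \<and> snd x \<noteq> snd y"

lemma primitive_cycle_iff: "primitive_cycle H c \<longleftrightarrow> c \<in> primitive_words (cycle_step H)"
proof -
  define P where "P x y \<longleftrightarrow>
    snd x \<in> hedges H \<and> fst x \<in> hends H (snd x) \<and> fst y \<in> hends H (snd x) \<and>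
    fst x \<noteq> fst y" for x y :: "'a \<times> 'b"
  have "closed_path H b \<longleftrightarrow>
      b \<noteq> [] \<and> (\<forall>i. P (cyclic_nth b i) (cyclic_nth b (Suc i)))" for b
    using all_less_cyclic_steps[of b P] by (auto simp: closed_path_def P_def)
  then have "primitive_cycle H c \<longleftrightarrow> c \<in> primitive_words (\<lambda>x y. P x y \<and> \<not> snd x = snd y)"
    unfolding primitive_cycle_def
    by (rule primitive_circuit_iff) (simp add: hyperedge_backtracking_def)
  also have "(\<lambda>x y. P x y \<and> \<not> snd x = snd y) = cycle_step H"
    by (simp add: fun_eq_iff P_def cycle_step_def)
  finally show ?thesis .
qed

lemma all_nat_Suc: "(\<forall>i::nat. Q i) \<longleftrightarrow> Q 0 \<and> (\<forall>i. Q (Suc i))"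
proof (intro iffI allI)
  fix i assume "Q 0 \<and> (\<forall>i. Q (Suc i))"
  then show "Q i"
    by (cases i) auto
qed auto

lemma (in pre_digraph) cas_iff_nth:
  assumes "p \<noteq> []"
  shows "cas u p v \<longleftrightarrow> tail G (hd p) = u \<and> head G (last p) = v \<and>
           (\<forall>i. Suc i < length p \<longrightarrow> head G (p ! i) = tail G (p ! Suc i))"
  using assms
proof (induction p arbitrary: u)
  case (Cons e p)
  show ?case
  proof (cases "p = []")
    case False
    have IH: "cas (head G e) p v \<longleftrightarrow> head G e = tail G (hd p) \<and> head G (last p) = v \<and>
        (\<forall>i. Suc i < length p \<longrightarrow> head G (p ! i) = tail G (p ! Suc i))"
      using Cons.IH[OF False, of "head G e"] by (simp only: eq_commute[of "head G e"])
    have steps: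
      "(\<forall>i. Suc i < length (e # p) \<longrightarrow> head G ((e # p) ! i) = tail G ((e # p) ! Suc i)) \<longleftrightarrow>
        head G e = tail G (hd p) \<and>
        (\<forall>i. Suc i < length p \<longrightarrow> head G (p ! i) = tail G (p ! Suc i))"
      using False by (subst all_nat_Suc) (simp add: hd_conv_nth)
    show ?thesis
      unfolding cas.simps IH steps list.sel last_ConsR[OF False] by blast
  qed simp
qed simp

lemma (in wf_digraph) closed_w_iff_cyclic_nth:
  "closed_w p \<longleftrightarrow> p \<noteq> [] \<and>
     (\<forall>i. cyclic_nth p i \<in> arcs G \<and> head G (cyclic_nth p i) = tail G (cyclic_nth p (Suc i)))"
proof (cases "p = []")
  case False
  have "tail G (hd p) \<in> verts G" if "set p \<subseteq> arcs G"
    using that hd_in_set[OF False] by (blast intro: tail_in_verts)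
  then have "closed_w p \<longleftrightarrow> set p \<subseteq> arcs G \<and> cas (tail G (hd p)) p (tail G (hd p))"
    using False by (auto simp: closed_w_def awalk_def cas_iff_nth)
  also have "\<dots> \<longleftrightarrow> (\<forall>i<length p. p ! i \<in> arcs G \<and>
                       head G (p ! i) = tail G (p ! (Suc i mod length p)))"
    (is "?L \<longleftrightarrow> ?R")
  proof
    assume L: ?L
    show ?R
    proof (intro allI impI conjI)
      fix i assume i: "i < length p"
      show "p ! i \<in> arcs G"
        using L i by auto
      show "head G (p ! i) = tail G (p ! (Suc i mod length p))"
      proof (cases "Suc i = length p")
        case True
        then have "p ! i = last p"
          using False by (metis diff_Suc_1 last_conv_nth)
        with True L False show ?thesis
          by (simp add: cas_iff_nth hd_conv_nth)
      qed (use i L False in \<open>simp add: cas_iff_nth\<close>)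
    qed
  next
    assume R: ?R
    have "head G (last p) = tail G (hd p)"
      using R[rule_format, of "length p - 1"] False
      by (simp add: last_conv_nth hd_conv_nth)
    moreover have "head G (p ! i) = tail G (p ! Suc i)" if "Suc i < length p" for i
      using R[rule_format, of i] that by simp
    ultimately show ?L
      using R False by (auto simp: cas_iff_nth in_set_conv_nth)
  qed
  also have "\<dots> \<longleftrightarrow> (\<forall>i. cyclic_nth p i \<in> arcs G \<and>
                       head G (cyclic_nth p i) = tail G (cyclic_nth p (Suc i)))"
    by (rule all_less_cyclic_steps[OF False, of "\<lambda>a b. a \<in> arcs G \<and> head G a = tail G b"])
  finally show ?thesis
    using False by simp
qed (simp add: closed_w_def)

definition geodesic_step ::
  "('a, 'b) pre_digraph \<Rightarrow> ('b \<Rightarrow> 'b) \<Rightarrow> 'b \<Rightarrow> 'b \<Rightarrow> bool" where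
  "geodesic_step G arev a b \<longleftrightarrow> (a \<in> arcs G \<and> head G a = tail G b) \<and> b \<noteq> arev a"

lemma (in wf_digraph) primitive_geodesic_iff:
  "primitive_geodesic G arev p \<longleftrightarrow> p \<in> primitive_words (geodesic_step G arev)"
proof -
  have "primitive_geodesic G arev p \<longleftrightarrow>
      p \<in> primitive_words (\<lambda>a b. (a \<in> arcs G \<and> head G a = tail G b) \<and> \<not> b = arev a)"
    unfolding primitive_geodesic_def
    by (rule primitive_circuit_iff) (simp_all add: closed_w_iff_cyclic_nth walk_backtracking_def)
  also have "(\<lambda>a b. (a \<in> arcs G \<and> head G a = tail G b) \<and> \<not> b = arev a) = geodesic_step G arev"
    by (simp add: fun_eq_iff geodesic_step_def)
  finally show ?thesis .
qed


section \<open>Subdividing closed paths\<close>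

text \<open>The arcs $v_i \to e_i$ and $e_i \to v_{i+1}$ sit at positions $2i$ and $2i+1$.\<close>

definition subdivision_arc :: "('v \<times> 'e) list \<Rightarrow> nat \<Rightarrow> ('v + 'e) \<times> ('v + 'e)" where
  "subdivision_arc c i =
     (if even i then (Inl (fst (cyclic_nth c (i div 2))), Inr (snd (cyclic_nth c (i div 2))))
      else (Inr (snd (cyclic_nth c (i div 2))), Inl (fst (cyclic_nth c (Suc (i div 2))))))"

definition subdivide_path :: "('v \<times> 'e) list \<Rightarrow> (('v + 'e) \<times> ('v + 'e)) list" where
  "subdivide_path c = map (subdivision_arc c) [0..<2 * length c]"

lemma subdivision_arc_even:
  "subdivision_arc c (2 * j) = (Inl (fst (cyclic_nth c j)), Inr (snd (cyclic_nth c j)))"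
  and subdivision_arc_odd:
  "subdivision_arc c (Suc (2 * j)) = (Inr (snd (cyclic_nth c j)), Inl (fst (cyclic_nth c (Suc j))))"
  by (simp_all add: subdivision_arc_def)

lemma all_nat_even_odd: "(\<forall>i::nat. Q i) \<longleftrightarrow> (\<forall>j. Q (2 * j) \<and> Q (Suc (2 * j)))"
proof (intro iffI allI)
  fix i assume "\<forall>j. Q (2 * j) \<and> Q (Suc (2 * j))"
  then show "Q i"
    by (cases "even i") (auto elim!: evenE oddE)
qed auto

lemma length_subdivide_path [simp]: "length (subdivide_path c) = 2 * length c"
  by (simp add: subdivide_path_def)

lemma subdivide_path_eq_Nil_iff [simp]: "subdivide_path c = [] \<longleftrightarrow> c = []"
  by (metis length_0_conv length_subdivide_path mult_is_0 zero_neq_numeral)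

lemma cyclic_nth_subdivide_path:
  assumes "c \<noteq> []"
  shows "cyclic_nth (subdivide_path c) i = subdivision_arc c i"
proof -
  have "i mod (2 * length c) < 2 * length c"
    using assms by simp
  then have "cyclic_nth (subdivide_path c) i = subdivision_arc c (i mod (2 * length c))"
    by (simp add: cyclic_nth_def subdivide_path_def)
  also have "\<dots> = subdivision_arc c i"
    using mod_mult2_eq[of i 2 "length c"]
    by (cases "even i")
      (simp_all add: subdivision_arc_def cyclic_nth_mod_length cyclic_nth_Suc_mod_length
        odd_iff_mod_2_eq_one)
  finally show ?thesis .
qed

lemma inj_subdivide_path: "inj subdivide_path"
proof (rule injI)
  fix c d :: "('v \<times> 'e) list"
  assume eq: "subdivide_path c = subdivide_path d"
  then have len: "length c = length d"
    by (metis length_subdivide_path mult_left_cancel zero_neq_numeral)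
  show "c = d"
  proof (cases "c = []")
    case False
    with len have "d \<noteq> []"
      by auto
    then have "subdivision_arc c (2 * j) = subdivision_arc d (2 * j)" for j
      using False eq by (metis cyclic_nth_subdivide_path)
    with len show ?thesis
      by (intro cyclic_nth_eqI) (auto simp: subdivision_arc_even prod_eq_iff)
  qed (use len in simp)
qed

lemma rotate_subdivide_path: "rotate (2 * k) (subdivide_path c) = subdivide_path (rotate k c)"
proof (cases "c = []")
  case False
  have "subdivision_arc c (2 * k + i) = subdivision_arc (rotate k c) i" for i
    using False by (auto simp: subdivision_arc_def cyclic_nth_rotate)
  then show ?thesis
    using False by (intro cyclic_nth_eqI) (simp_all add: cyclic_nth_rotate cyclic_nth_subdivide_path)
qed (simp add: subdivide_path_def)

text \<open>An odd rotation of a subdivision starts in a hyperedge and so is not a subdivision.\<close>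

lemma rotate_subdivide_path_eq_iff:
  assumes "c \<noteq> []"
  shows "rotate n (subdivide_path c) = subdivide_path d \<longleftrightarrow> (\<exists>k. n = 2 * k \<and> rotate k c = d)"
proof
  assume eq: "rotate n (subdivide_path c) = subdivide_path d"
  then have "d \<noteq> []"
    using assms by (metis rotate_is_Nil_conv subdivide_path_eq_Nil_iff)
  then have "subdivision_arc c n = subdivision_arc d 0"
    using assms arg_cong[OF eq, of "\<lambda>p. cyclic_nth p 0"]
    by (simp add: cyclic_nth_rotate cyclic_nth_subdivide_path)
  then have "even n"
    by (auto simp: subdivision_arc_def split: if_splits)
  then obtain k where "n = 2 * k"
    by (elim evenE)
  with eq inj_subdivide_path show "\<exists>k. n = 2 * k \<and> rotate k c = d"
    by (auto simp: rotate_subdivide_path dest: injD)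
qed (auto simp: rotate_subdivide_path)

lemma aperiodic_subdivide_path: "aperiodic (subdivide_path c) \<longleftrightarrow> aperiodic c"
proof (cases "c = []")
  case False
  then have "aperiodic (subdivide_path c) \<longleftrightarrow>
      (\<forall>k. 2 * k dvd 2 * length c \<longrightarrow> rotate k c = c \<longrightarrow> 2 * k = 2 * length c)"
    unfolding aperiodic_def subdivide_path_eq_Nil_iff length_subdivide_path
      rotate_subdivide_path_eq_iff[OF False] by blast
  with False show ?thesis
    by (simp add: aperiodic_def)
qed (simp add: aperiodic_def)

abbreviation bipartite_step ::
  "('v, 'e) hypergraph \<Rightarrow> ('v + 'e) \<times> ('v + 'e) \<Rightarrow> ('v + 'e) \<times> ('v + 'e) \<Rightarrow> bool" where
  "bipartite_step H \<equiv>
     geodesic_step (with_proj (bipartite_graph H)) (swap_in (parcs (bipartite_graph H)))"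

lemma pair_primitive_geodesic_iff:
  "primitive_geodesic (with_proj (bipartite_graph H)) (swap_in (parcs (bipartite_graph H))) p \<longleftrightarrow>
   p \<in> primitive_words (bipartite_step H)"
proof -
  interpret pair_bidirected_digraph "bipartite_graph H"
    by (rule pair_bidirected_bipartite_graph)
  show ?thesis
    by (rule primitive_geodesic_iff)
qed

text \<open>
  At the middle of a hyperedge the geodesic condition says $v_i \ne v_{i+1}$, at a hypervertex it
  says $e_i \ne e_{i+1}$.
\<close>

lemma bipartite_steps_subdivision:
  assumes "is_hypergraph H"
  shows "(\<forall>i. bipartite_step H (subdivision_arc c i) (subdivision_arc c (Suc i))) \<longleftrightarrow>
         (\<forall>j. cycle_step H (cyclic_nth c j) (cyclic_nth c (Suc j)))"
proof -
  have ends: "v \<in> hverts H" if "e \<in> hedges H" "v \<in> hends H e" for v e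
    using assms that by (auto simp: is_hypergraph_def)
  have out_arc: "(Inl v, Inr e) \<in> parcs (bipartite_graph H) \<longleftrightarrow> e \<in> hedges H \<and> v \<in> hends H e"
    and in_arc: "(Inr e, Inl v) \<in> parcs (bipartite_graph H) \<longleftrightarrow> e \<in> hedges H \<and> v \<in> hends H e"
    for v e
    using ends by (auto simp: bipartite_graph_def)
  have next_even: "subdivision_arc c (Suc (Suc (2 * j))) =
      (Inl (fst (cyclic_nth c (Suc j))), Inr (snd (cyclic_nth c (Suc j))))" for j
    using subdivision_arc_even[of c "Suc j"] by simp
  have "bipartite_step H (subdivision_arc c (2 * j)) (subdivision_arc c (Suc (2 * j))) \<and>
      bipartite_step H (subdivision_arc c (Suc (2 * j))) (subdivision_arc c (Suc (Suc (2 * j)))) \<longleftrightarrow>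
      cycle_step H (cyclic_nth c j) (cyclic_nth c (Suc j))" for j
    unfolding subdivision_arc_even subdivision_arc_odd next_even geodesic_step_def cycle_step_def
    by (auto simp: swap_in_def out_arc in_arc)
  then show ?thesis
    by (subst all_nat_even_odd) simp
qed

lemma subdivide_path_mem_primitive_words_iff:
  assumes "is_hypergraph H"
  shows "subdivide_path c \<in> primitive_words (bipartite_step H) \<longleftrightarrow> c \<in> primitive_words (cycle_step H)"
proof (cases "c = []")
  case False
  then show ?thesis
    using bipartite_steps_subdivision[OF assms, of c]
    by (simp add: primitive_words_def aperiodic_subdivide_path cyclic_nth_subdivide_path)
qed (simp add: primitive_words_def aperiodic_def)

lemma bipartite_step_alternates:
  assumes "bipartite_step H a b"
  shows "snd a = fst b" "isl (snd a) \<longleftrightarrow> \<not> isl (fst a)" "isl (fst b) \<longleftrightarrow> \<not> isl (fst a)"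
proof -
  have arc: "a \<in> parcs (bipartite_graph H)" and eq: "snd a = fst b"
    using assms by (auto simp: geodesic_step_def)
  from arc show "isl (snd a) \<longleftrightarrow> \<not> isl (fst a)"
    by (auto simp: bipartite_graph_def)
  then show "isl (fst b) \<longleftrightarrow> \<not> isl (fst a)" "snd a = fst b"
    by (simp_all add: eq)
qed

text \<open>
  The letters at even positions spell the closed path: because the arcs of $B_H$ alternate
  between the two sides, they are the arcs from hypervertices to hyperedges.
\<close>

lemma primitive_word_is_subdivision:
  assumes p: "p \<in> primitive_words (bipartite_step H)" and start: "isl (fst (cyclic_nth p 0))"
  obtains c where "p = subdivide_path c"
proof -
  have ne: "p \<noteq> []" and step: "bipartite_step H (cyclic_nth p i) (cyclic_nth p (Suc i))" for i
    using p by (auto simp: primitive_words_def aperiodic_def)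
  have parity: "isl (fst (cyclic_nth p i)) \<longleftrightarrow> even i" for i
    by (induction i) (simp_all add: start bipartite_step_alternates(3)[OF step])
  have "cyclic_nth p (length p) = cyclic_nth p 0"
    by (simp add: cyclic_nth_def)
  then have "even (length p)"
    using parity by (metis even_zero)
  then obtain n where n: "length p = 2 * n"
    by (elim evenE)
  define c where
    "c = map (\<lambda>j. (projl (fst (cyclic_nth p (2 * j))), projr (snd (cyclic_nth p (2 * j))))) [0..<n]"
  have len: "length c = n" and cne: "c \<noteq> []"
    using n ne by (cases n; simp add: c_def)+
  have c_nth: "cyclic_nth c j =
      (projl (fst (cyclic_nth p (2 * j))), projr (snd (cyclic_nth p (2 * j))))" for j
  proof -
    have "j mod n < n"
      using len cne by auto
    then have "cyclic_nth c j =
        (projl (fst (cyclic_nth p (2 * (j mod n)))), projr (snd (cyclic_nth p (2 * (j mod n)))))"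
      unfolding cyclic_nth_def[of c] len unfolding c_def by simp
    moreover have "2 * (j mod n) = 2 * j mod length p"
      by (simp add: n)
    ultimately show ?thesis
      by (simp only: cyclic_nth_mod_length)
  qed
  have even_arc: "subdivision_arc c (2 * j) = cyclic_nth p (2 * j)" for j
    using parity[of "2 * j"] bipartite_step_alternates(2)[OF step, of "2 * j"]
    by (simp add: subdivision_arc_even c_nth prod_eq_iff)
  \<comment> \<open>An arc at an odd position is determined by its two even neighbours.\<close>
  have odd_arc: "subdivision_arc c (Suc (2 * j)) = cyclic_nth p (Suc (2 * j))" for j
  proof -
    have "subdivision_arc c (Suc (2 * j)) =
        (snd (subdivision_arc c (2 * j)), fst (subdivision_arc c (2 * Suc j)))"
      by (simp only: subdivision_arc_even subdivision_arc_odd fst_conv snd_conv)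
    also have "\<dots> = cyclic_nth p (Suc (2 * j))"
      using bipartite_step_alternates(1)[OF step, of "2 * j"]
        bipartite_step_alternates(1)[OF step, of "Suc (2 * j)"]
      by (simp only: even_arc prod_eq_iff) simp
    finally show ?thesis .
  qed
  have "\<forall>i. subdivision_arc c i = cyclic_nth p i"
    by (subst all_nat_even_odd) (simp add: even_arc odd_arc)
  then have "p = subdivide_path c"
    using cne len n by (intro cyclic_nth_eqI) (simp_all add: cyclic_nth_subdivide_path)
  then show thesis
    by (rule that)
qed


section \<open>The bijection between prime cycles and prime geodesics\<close>

lemma bij_betw_cyclic_classes:
  assumes maps: "\<And>c. c \<in> S \<Longrightarrow> f c \<in> T"
    and rel: "\<And>c d. c \<in> S \<Longrightarrow> d \<in> S \<Longrightarrow> (f c, f d) \<in> cyclic_rel T \<longleftrightarrow> (c, d) \<in> cyclic_rel S"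
    and surj: "\<And>t. t \<in> T \<Longrightarrow> \<exists>c\<in>S. (f c, t) \<in> cyclic_rel T"
  shows "bij_betw (\<lambda>P. cyclic_rel T `` (f ` P)) (cyclic_classes S) (cyclic_classes T)"
proof -
  note S = equiv_cyclic_rel[of S] and T = equiv_cyclic_rel[of T]
  have image: "cyclic_rel T `` (f ` (cyclic_rel S `` {c})) = cyclic_rel T `` {f c}"
    if c: "c \<in> S" for c
  proof -
    have "cyclic_rel T `` {f d} = cyclic_rel T `` {f c}" if "(c, d) \<in> cyclic_rel S" for d
      using that c rel[of c d] equiv_class_eq[OF T, of "f c" "f d"]
      by (auto simp: cyclic_rel_def)
    moreover have "c \<in> cyclic_rel S `` {c}"
      using equiv_class_self[OF S c] .
    ultimately show ?thesis
      by blast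
  qed
  show ?thesis
    unfolding bij_betw_def
  proof
    show "inj_on (\<lambda>P. cyclic_rel T `` (f ` P)) (cyclic_classes S)"
    proof (rule inj_onI)
      fix P Q
      assume "P \<in> cyclic_classes S" "Q \<in> cyclic_classes S"
      then obtain c d where cd: "c \<in> S" "P = cyclic_rel S `` {c}" "d \<in> S" "Q = cyclic_rel S `` {d}"
        by (auto simp: cyclic_classes_def elim!: quotientE)
      assume "cyclic_rel T `` (f ` P) = cyclic_rel T `` (f ` Q)"
      then have "cyclic_rel T `` {f c} = cyclic_rel T `` {f d}"
        using cd by (simp add: image)
      then have "(c, d) \<in> cyclic_rel S"
        using cd rel maps eq_equiv_class_iff[OF T] by blast
      then show "P = Q"
        using cd equiv_class_eq[OF S] by blast
    qed
    show "(\<lambda>P. cyclic_rel T `` (f ` P)) ` cyclic_classes S = cyclic_classes T"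
    proof (intro equalityI subsetI)
      fix Q assume "Q \<in> (\<lambda>P. cyclic_rel T `` (f ` P)) ` cyclic_classes S"
      then obtain c where "c \<in> S" "Q = cyclic_rel T `` {f c}"
        by (auto simp: cyclic_classes_def image elim!: quotientE)
      then show "Q \<in> cyclic_classes T"
        using maps by (auto simp: cyclic_classes_def intro: quotientI)
    next
      fix Q assume "Q \<in> cyclic_classes T"
      then obtain t where t: "t \<in> T" "Q = cyclic_rel T `` {t}"
        by (auto simp: cyclic_classes_def elim!: quotientE)
      then obtain c where c: "c \<in> S" "(f c, t) \<in> cyclic_rel T"
        using surj by blast
      then have "Q = cyclic_rel T `` (f ` (cyclic_rel S `` {c}))"
        using t equiv_class_eq[OF T c(2)] by (simp add: image)
      then show "Q \<in> (\<lambda>P. cyclic_rel T `` (f ` P)) ` cyclic_classes S"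
        using c by (auto simp: cyclic_classes_def intro: quotientI)
    qed
  qed
qed

text \<open>
  The subdivisions of the members of a class are only the even rotations of one walk; the odd ones
  are added by closing under \<^const>\<open>cyclic_rel\<close>.
\<close>

definition subdivide_class ::
  "('v, 'e) hypergraph \<Rightarrow> ('v \<times> 'e) list set \<Rightarrow> (('v + 'e) \<times> ('v + 'e)) list set" where
  "subdivide_class H P = cyclic_rel (primitive_words (bipartite_step H)) `` (subdivide_path ` P)"

lemma prime_cycles_eq: "prime_cycles H = cyclic_classes (primitive_words (cycle_step H))"
  by (simp add: prime_cycles_def primitive_cycle_iff)

lemma pair_prime_geodesics_eq:
  "pair_prime_geodesics (bipartite_graph H) = cyclic_classes (primitive_words (bipartite_step H))"
  by (simp add: prime_geodesics_def pair_primitive_geodesic_iff)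

lemma bij_betw_prime_cycles_prime_geodesics:
  assumes H: "is_hypergraph H"
  shows "bij_betw (subdivide_class H) (prime_cycles H) (pair_prime_geodesics (bipartite_graph H))"
  unfolding prime_cycles_eq pair_prime_geodesics_eq subdivide_class_def
proof (rule bij_betw_cyclic_classes)
  let ?S = "primitive_words (cycle_step H)" and ?T = "primitive_words (bipartite_step H)"
  note mem = subdivide_path_mem_primitive_words_iff[OF H]
  show "subdivide_path c \<in> ?T" if "c \<in> ?S" for c
    using that by (simp add: mem)
  show "(subdivide_path c, subdivide_path d) \<in> cyclic_rel ?T \<longleftrightarrow> (c, d) \<in> cyclic_rel ?S"
    if c: "c \<in> ?S" and d: "d \<in> ?S" for c d
  proof -
    have "(\<exists>n. subdivide_path d = rotate n (subdivide_path c)) \<longleftrightarrow> (\<exists>k. d = rotate k c)"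
      using rotate_subdivide_path_eq_iff[OF primitive_words_nonempty[OF c], of _ d] by metis
    with c d show ?thesis
      by (simp add: cyclic_rel_def mem)
  qed
  show "\<exists>c\<in>?S. (subdivide_path c, t) \<in> cyclic_rel ?T" if t: "t \<in> ?T" for t
  proof -
    have ne: "t \<noteq> []"
      using t by (rule primitive_words_nonempty)
    have "bipartite_step H (cyclic_nth t 0) (cyclic_nth t (Suc 0))"
      using t by (simp add: primitive_words_def)
    \<comment> \<open>One of two consecutive arcs starts in a hypervertex.\<close>
    then obtain k where "isl (fst (cyclic_nth t k))"
      using bipartite_step_alternates(3) by blast
    then have "isl (fst (cyclic_nth (rotate k t) 0))"
      using ne by (simp add: cyclic_nth_rotate)
    moreover have rot: "rotate k t \<in> ?T"
      using t by (rule primitive_words_rotate)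
    ultimately obtain c where c: "rotate k t = subdivide_path c"
      using primitive_word_is_subdivision by blast
    have "(t, subdivide_path c) \<in> cyclic_rel ?T"
      using t rot by (auto simp: cyclic_rel_def simp flip: c)
    then have "(subdivide_path c, t) \<in> cyclic_rel ?T"
      using equiv_cyclic_rel by (metis equiv_def symD)
    moreover have "c \<in> ?S"
      using rot c mem by simp
    ultimately show ?thesis
      by blast
  qed
qed

lemma class_length_subdivide_class:
  assumes H: "is_hypergraph H" and P: "P \<in> prime_cycles H"
  shows "class_length (subdivide_class H P) = 2 * class_length P"
proof -
  let ?S = "primitive_words (cycle_step H)" and ?T = "primitive_words (bipartite_step H)"
  obtain c where c: "c \<in> ?S" "c \<in> P"
    using P equiv_class_self[OF equiv_cyclic_rel]
    by (auto simp: prime_cycles_eq cyclic_classes_def elim!: quotientE)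
  have "subdivide_path c \<in> ?T"
    using c H by (simp add: subdivide_path_mem_primitive_words_iff)
  then have "subdivide_path c \<in> cyclic_rel ?T `` {subdivide_path c}"
    by (rule equiv_class_self[OF equiv_cyclic_rel])
  then have "subdivide_path c \<in> subdivide_class H P"
    using c by (auto simp: subdivide_class_def)
  moreover have "subdivide_class H P \<in> cyclic_classes ?T"
    using bij_betw_apply[OF bij_betw_prime_cycles_prime_geodesics[OF H] P]
    by (simp add: pair_prime_geodesics_eq)
  ultimately have "class_length (subdivide_class H P) = length (subdivide_path c)"
    by (intro class_length_eq)
  moreover have "class_length P = length c"
    using P c by (intro class_length_eq) (simp_all add: prime_cycles_eq)
  ultimately show ?thesis
    by simp
qed


section \<open>Convergence of Euler products\<close>

lemma has_unordered_prod_reindex_bij_betw: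
  assumes "bij_betw h A B" "\<And>x. x \<in> A \<Longrightarrow> g (h x) = f x"
  shows "has_unordered_prod g B z \<longleftrightarrow> has_unordered_prod f A z"
proof -
  have inj: "inj_on h A" and B: "B = h ` A"
    using assms(1) by (auto simp: bij_betw_def)
  have "(prod g \<longlongrightarrow> z) (finite_subsets_at_top B) \<longleftrightarrow>
      ((\<lambda>X. prod g (h ` X)) \<longlongrightarrow> z) (finite_subsets_at_top A)"
    unfolding B filtermap_image_finite_subsets_at_top[OF inj, symmetric]
    by (simp add: filterlim_filtermap)
  also have "\<dots> \<longleftrightarrow> (prod f \<longlongrightarrow> z) (finite_subsets_at_top A)"
  proof (intro tendsto_cong eventually_finite_subsets_at_top_weakI)
    fix X assume "finite X" "X \<subseteq> A"
    then have "prod g (h ` X) = prod (g \<circ> h) X"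
      using inj by (intro prod.reindex) (rule inj_on_subset)
    also have "\<dots> = prod f X"
      using assms(2) \<open>X \<subseteq> A\<close> by (intro prod.cong) auto
    finally show "prod g (h ` X) = prod f X" .
  qed
  finally show ?thesis
    by (simp add: has_unordered_prod_def)
qed

lemma unordered_prod_eqI: "has_unordered_prod f A z \<Longrightarrow> unordered_prod f A = z"
  unfolding has_unordered_prod_def unordered_prod_def
  by (elim conjE) (rule tendsto_Lim; simp)

text \<open>The product is the exponential of the sum of logarithms, and so is nonzero.\<close>

lemma multipliable_on_inverse_one_minus:
  assumes "(\<lambda>x. norm (g x)) summable_on A" "\<And>x. x \<in> A \<Longrightarrow> norm (g x) < 1/2"
  shows "multipliable_on (\<lambda>x. inverse (1 - g x)) A"
proof -
  define L where "L x = - Ln (1 - g x)" for x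
  have "norm (L x) \<le> 2 * norm (g x)" if "x \<in> A" for x
    using norm_Ln_le[of "- g x"] assms(2)[OF that] by (simp add: L_def)
  then have "(\<lambda>x. norm (L x)) summable_on A"
    by (rule Infinite_Sum.abs_summable_on_comparison_test'[OF
        summable_on_cmult_right[OF assms(1)]])
  then have "L summable_on A"
    by (rule abs_summable_summable)
  then obtain s where "(L has_sum s) A"
    by (auto simp: summable_on_def)
  then have "((\<lambda>X. exp (sum L X)) \<longlongrightarrow> exp s) (finite_subsets_at_top A)"
    unfolding has_sum_def by (rule tendsto_exp)
  also have "?this \<longleftrightarrow> (prod (\<lambda>x. inverse (1 - g x)) \<longlongrightarrow> exp s) (finite_subsets_at_top A)"
  proof (intro tendsto_cong eventually_finite_subsets_at_top_weakI)
    fix X assume X: "finite X" "X \<subseteq> A"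
    have "exp (L x) = inverse (1 - g x)" if "x \<in> A" for x
    proof -
      have "1 - g x \<noteq> 0"
        using assms(2)[OF that] by auto
      then show ?thesis
        by (simp add: L_def exp_minus)
    qed
    with X show "exp (sum L X) = prod (\<lambda>x. inverse (1 - g x)) X"
      by (auto simp: exp_sum intro!: prod.cong)
  qed
  finally show ?thesis
    unfolding multipliable_on_def has_unordered_prod_def by (intro exI[of _ "exp s"]) simp
qed

text \<open>There are \<open>card A ^ n\<close> words of length \<open>n\<close>, so this is a geometric series.\<close>

lemma summable_on_lists_power_length:
  fixes x :: real
  assumes A: "finite A" and x: "0 \<le> x" "card A * x < 1"
  shows "(\<lambda>c. x ^ length c) summable_on lists A"
proof (rule nonneg_bdd_above_summable_on)
  let ?W = "\<lambda>n. {c. set c \<subseteq> A \<and> length c = n}"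
  have "(\<Sum>c\<in>F. x ^ length c) \<le> 1 / (1 - card A * x)" if F: "F \<subseteq> lists A" "finite F" for F
  proof -
    define N where "N = Suc (Max (insert 0 (length ` F)))"
    have "length c < N" if "c \<in> F" for c
      using that F by (auto simp: N_def less_Suc_eq_le)
    with F have "F \<subseteq> (\<Union>n<N. ?W n)"
      by auto
    then have "(\<Sum>c\<in>F. x ^ length c) \<le> (\<Sum>c\<in>(\<Union>n<N. ?W n). x ^ length c)"
      using A x by (intro sum_mono2) (auto intro: finite_lists_length_eq)
    also have "\<dots> = (\<Sum>n<N. \<Sum>c\<in>?W n. x ^ length c)"
      using A by (intro sum.UNION_disjoint) (auto intro: finite_lists_length_eq)
    also have "\<dots> = (\<Sum>n<N. (card A * x) ^ n)"
      using A by (intro sum.cong) (simp_all add: card_lists_length_eq power_mult_distrib)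
    also have "\<dots> \<le> (\<Sum>n. (card A * x) ^ n)"
      using x by (intro sum_le_suminf summable_geometric) auto
    also have "\<dots> = 1 / (1 - card A * x)"
      using x by (intro suminf_geometric) auto
    finally show ?thesis .
  qed
  then show "bdd_above (sum (\<lambda>c. x ^ length c) ` {F. F \<subseteq> lists A \<and> finite F})"
    by (intro bdd_aboveI2[where M = "1 / (1 - card A * x)"]) auto
qed (use x in simp)

text \<open>
  The empty word would contribute the factor \<open>inverse 0 = 0\<close>. The radius ensures both
  \<open>card A * norm u < 1\<close>, for the geometric series, and \<open>norm u < 1/2\<close>, for the logarithms.
\<close>

lemma multipliable_on_euler_factor:
  assumes A: "finite A" and S: "S \<subseteq> lists A" "[] \<notin> S" and u: "norm u < 1 / (real (card A) + 2)"
  shows "multipliable_on (euler_factor u) (cyclic_classes S)"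
proof -
  let ?C = "cyclic_classes S"
  \<comment> \<open>Classes are counted by the words that represent them.\<close>
  define rep where "rep P = (SOME c. c \<in> P)" for P :: "'a list set"
  have ex: "\<exists>c. c \<in> P" if "P \<in> ?C" for P
    using that equiv_class_self[OF equiv_cyclic_rel]
    by (auto simp: cyclic_classes_def elim!: quotientE)
  have rep: "rep P \<in> P" if "P \<in> ?C" for P
    unfolding rep_def using ex[OF that] by (rule someI_ex)
  have sub: "P \<subseteq> S" if "P \<in> ?C" for P
    using that by (auto simp: cyclic_classes_def cyclic_rel_def elim!: quotientE)
  have inj: "inj_on rep ?C"
  proof (rule inj_onI)
    fix P Q assume PQ: "P \<in> ?C" "Q \<in> ?C" "rep P = rep Q"
    then have "P \<inter> Q \<noteq> {}"
      using rep by (metis disjoint_iff)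
    then show "P = Q"
      using quotient_disj[OF equiv_cyclic_rel] PQ by (auto simp: cyclic_classes_def)
  qed
  have len: "class_length P = length (rep P)" if "P \<in> ?C" for P
    using that rep class_length_eq by blast
  have u1: "card A * norm u < 1" and u2: "norm u < 1/2"
  proof -
    have *: "card A * norm u + 2 * norm u < 1"
      using u by (simp add: field_simps)
    have "0 \<le> card A * norm u" "0 \<le> norm u"
      by simp_all
    with * show "card A * norm u < 1" "norm u < 1/2"
      by linarith+
  qed
  have "(\<lambda>c. norm u ^ length c) summable_on lists A"
    using A u1 by (intro summable_on_lists_power_length) auto
  then have "(\<lambda>c. norm u ^ length c) summable_on rep ` ?C"
    by (rule summable_on_subset_banach) (use rep sub S in blast)
  then have "(\<lambda>P. norm (u ^ class_length P)) summable_on ?C"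
    unfolding summable_on_reindex[OF inj]
    by (rule back_subst) (auto intro!: summable_on_cong simp: len norm_power)
  moreover have "norm (u ^ class_length P) < 1/2" if P: "P \<in> ?C" for P
  proof -
    have "rep P \<noteq> []"
      using subsetD[OF sub[OF P] rep[OF P]] S(2) by auto
    then have "class_length P \<noteq> 0"
      using len[OF P] by simp
    then obtain n where "class_length P = Suc n"
      using not0_implies_Suc by blast
    then have "norm (u ^ class_length P) = norm u * norm u ^ n"
      by (simp add: norm_mult norm_power)
    also have "\<dots> \<le> norm u * 1"
      using u2 by (intro mult_left_mono power_le_one) auto
    finally show ?thesis
      using u2 by simp
  qed
  ultimately show ?thesis
    unfolding euler_factor_def by (rule multipliable_on_inverse_one_minus)
qed

lemma primitive_words_cycle_step_subset:
  assumes "is_hypergraph H"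
  shows "primitive_words (cycle_step H) \<subseteq> lists (hverts H \<times> hedges H)"
proof
  fix c assume c: "c \<in> primitive_words (cycle_step H)"
  have "x \<in> hverts H \<times> hedges H" if x: "x \<in> set c" for x
  proof -
    obtain i where "i < length c" "x = c ! i"
      using x by (metis in_set_conv_nth)
    then have "x = cyclic_nth c i"
      by (simp add: cyclic_nth_less)
    then have "cycle_step H x (cyclic_nth c (Suc i))"
      using c by (simp add: primitive_words_def)
    with assms show ?thesis
      by (cases x) (auto simp: cycle_step_def is_hypergraph_def)
  qed
  then show "c \<in> lists (hverts H \<times> hedges H)"
    by auto
qed

theorem theorem10:
  fixes H :: "('v, 'e) hypergraph"
  assumes "is_hypergraph H"
    and "finite_hypergraph H"
    and "connected_hypergraph H"
    and "\<forall>v\<in>hverts H. card {e \<in> hedges H. v \<in> hends H e} \<ge> 2"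
  shows "\<exists>r>0. \<forall>u w :: complex. norm u < r \<longrightarrow> w\<^sup>2 = u \<longrightarrow>
           multipliable_on (euler_factor u) (prime_cycles H) \<and>
           multipliable_on (euler_factor w) (pair_prime_geodesics (bipartite_graph H)) \<and>
           hypergraph_zeta H u = pair_ihara_zeta (bipartite_graph H) w"
proof -
  define r where "r = 1 / (real (card (hverts H \<times> hedges H)) + 2)"
  show ?thesis
  proof (intro exI[of _ r] conjI allI impI)
    show "0 < r"
      by (simp add: r_def add_nonneg_pos)
    fix u w :: complex
    assume u: "norm u < r" and w: "w\<^sup>2 = u"
    show "multipliable_on (euler_factor u) (prime_cycles H)"
      unfolding prime_cycles_eq
    proof (rule multipliable_on_euler_factor)
      show "finite (hverts H \<times> hedges H)"
        using assms(2) by (simp add: finite_hypergraph_def)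
      show "primitive_words (cycle_step H) \<subseteq> lists (hverts H \<times> hedges H)"
        using assms(1) by (rule primitive_words_cycle_step_subset)
      show "[] \<notin> primitive_words (cycle_step H)"
        using primitive_words_nonempty by blast
    qed (use u in \<open>simp add: r_def\<close>)
    then obtain z where z: "has_unordered_prod (euler_factor u) (prime_cycles H) z"
      by (auto simp: multipliable_on_def)
    have "euler_factor w (subdivide_class H P) = euler_factor u P" if "P \<in> prime_cycles H" for P
      using class_length_subdivide_class[OF assms(1) that] w
      by (simp add: euler_factor_def power_mult)
    then have z': "has_unordered_prod (euler_factor w) (pair_prime_geodesics (bipartite_graph H)) z"
      using has_unordered_prod_reindex_bij_betw[OF
          bij_betw_prime_cycles_prime_geodesics[OF assms(1)]] z by blast
    then show "multipliable_on (euler_factor w) (pair_prime_geodesics (bipartite_graph H))"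
      by (auto simp: multipliable_on_def)
    show "hypergraph_zeta H u = pair_ihara_zeta (bipartite_graph H) w"
      using unordered_prod_eqI[OF z] unordered_prod_eqI[OF z']
      by (simp add: hypergraph_zeta_def ihara_zeta_def)
  qed
qed

end
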